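(* Let $(F,m,\eta;\delta,\varepsilon)$ be a weak Frobenius monad on a category $\mathbb{B}$. Let $\mathbb{C}$ be the category of compatible $F$-comodules, $\mathbb{M}$ the category of compatible $F$-modules, and $\mathbb{D}$ the category of those Frobenius $F$-bimodules $(B,\varrho,\omega)$ for which $(B,\omega)$ is a compatible $F$-comodule and $(B,\varrho)$ is a compatible $F$-module (morphisms: morphisms of $\mathbb{B}$ that are both $F$-module and $F$-comodule morphisms). Then there are functors, acting as the identity on morphisms, $$\Psi:\mathbb{C}\to\mathbb{D},\quad (B,\omega)\mapsto (B,\ \varepsilon_B\cdot m_B\cdot F(\omega),\ \omega),\qquad \Phi:\mathbb{M}\to\mathbb{D},\quad (B,\varrho)\mapsto (B,\ \varrho,\ F(\varrho)\cdot\delta_B\cdot\eta_B),$$ and, together with the forgetful functors $U^F:\mathbb{D}\to\mathbb{M}$, $(B,\varrho,\omega)\mapsto(B,\varrho)$, and $U_F:\mathbb{D}\to\mathbb{C}$, $(B,\varrho,\omega)\mapsto(B,\omega)$, they yield category isomorphisms $$\mathbb{C}\xrightarrow{\ \Psi\ }\mathbb{D}\xrightarrow{\ U^F\ }\mathbb{M},\qquad \mathbb{M}\xrightarrow{\ \Phi\ }\mathbb{D}\xrightarrow{\ U_F\ }\mathbb{C}.$$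
   Context: Let $F:\mathbb{B}\to\mathbb{B}$ be an endofunctor. A non-unital monad $(F,m)$ has an associative natural transformation $m:FF\to F$ ($m\cdot Fm=m\cdot mF$). Its (non-unital) modules are pairs $(B,\varrho)$ with $\varrho:F(B)\to B$ and $\varrho\cdot F(\varrho)=\varrho\cdot m_B$. A weak monad $(F,m,\eta)$ is a non-unital monad with a natural transformation $\eta:I_{\mathbb{B}}\to F$ such that $\eta=m\cdot F\eta\cdot\eta$, $m=m\cdot mF\cdot F\eta F$ and $m\cdot F\eta=m\cdot\eta F$. A module $(B,\varrho)$ is compatible if $\varrho=\varrho\cdot m_B\cdot F(\eta_B)$. A non-counital comonad $(F,\delta)$ has a coassociative natural transformation $\delta:F\to FF$ ($F\delta\cdot\delta=\delta F\cdot\delta$). Its (non-counital) comodules are pairs $(B,\omega)$ with $\omega:B\to F(B)$ and $F(\omega)\cdot\omega=\delta_B\cdot\omega$. A weak comonad $(F,\delta,\varepsilon)$ is a non-counital comonad with a natural transformation $\varepsilon:F\to I_{\mathbb{B}}$ such that $\varepsilon=\varepsilon\cdot F\varepsilon\cdot\delta$, $\delta=F\varepsilon F\cdot F\delta\cdot\delta$ and $F\varepsilon\cdot\delta=\varepsilon F\cdot\delta$. A comodule $(B,\omega)$ is compatible if $\omega=F(\varepsilon_B)\cdot\delta_B\cdot\omega$. Module (comodule) morphisms are morphisms of $\mathbb{B}$ commuting with the structure maps; the categories of compatible modules (comodules) are full subcategories of the categories of all non-unital modules (non-counital comodules). $(F,m,\delta)$ has the Frobenius property if $Fm\cdot\delta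 F=\delta\cdot m=mF\cdot F\delta$. A Frobenius bimodule is a triple $(B,\varrho,\omega)$ with $(B,\varrho)$ a (non-unital) module, $(B,\omega)$ a (non-counital) comodule and $F(\varrho)\cdot\delta_B=\omega\cdot\varrho=m_B\cdot F(\omega)$. $(F,m,\eta;\delta,\varepsilon)$ is a weak Frobenius monad if $(F,m,\eta)$ is a weak monad, $(F,\delta,\varepsilon)$ is a weak comonad, $(F,m,\delta)$ has the Frobenius property, and $m\cdot F\eta=F\varepsilon\cdot\delta$. *)

theory Defs
  imports Main
begin

section \<open>Categories, functors and natural transformations\<close>

record ('o, 'a) category =
  Obj :: "'o set"
  Arr :: "'a set"
  Dom :: "'a \<Rightarrow> 'o"
  Cod :: "'a \<Rightarrow> 'o"
  Id :: "'o \<Rightarrow> 'a"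
  Comp :: "'a \<Rightarrow> 'a \<Rightarrow> 'a"  (infixr "\<cdot>\<index>" 70)

definition hom :: "('o, 'a) category \<Rightarrow> 'o \<Rightarrow> 'o \<Rightarrow> 'a set" where
  "hom C x y = {f \<in> Arr C. Dom C f = x \<and> Cod C f = y}"

locale category =
  fixes C :: "('o, 'a) category" (structure)
  assumes dom_obj: "f \<in> Arr C \<Longrightarrow> Dom C f \<in> Obj C"
    and cod_obj: "f \<in> Arr C \<Longrightarrow> Cod C f \<in> Obj C"
    and id_hom: "x \<in> Obj C \<Longrightarrow> Id C x \<in> hom C x x"
    and comp_hom: "\<lbrakk>f \<in> hom C x y; g \<in> hom C y z\<rbrakk> \<Longrightarrow> g \<cdot> f \<in> hom C x z"
    and id_left: "f \<in> hom C x y \<Longrightarrow> Id C y \<cdot> f = f"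
    and id_right: "f \<in> hom C x y \<Longrightarrow> f \<cdot> Id C x = f"
    and assoc: "\<lbrakk>f \<in> hom C x y; g \<in> hom C y z; h \<in> hom C z w\<rbrakk>
      \<Longrightarrow> (h \<cdot> g) \<cdot> f = h \<cdot> (g \<cdot> f)"

record ('o, 'a, 'p, 'b) cfunctor =
  fobj :: "'o \<Rightarrow> 'p"
  farr :: "'a \<Rightarrow> 'b"

locale cat_functor = source: category C + target: category D
  for C :: "('o, 'a) category" and D :: "('p, 'b) category" +
  fixes F :: "('o, 'a, 'p, 'b) cfunctor"
  assumes fobj_obj: "x \<in> Obj C \<Longrightarrow> fobj F x \<in> Obj D"
    and farr_hom: "f \<in> hom C x y \<Longrightarrow> farr F f \<in> hom D (fobj F x) (fobj F y)"
    and farr_id: "x \<in> Obj C \<Longrightarrow> farr F (Id C x) = Id D (fobj F x)"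
    and farr_comp: "\<lbrakk>f \<in> hom C x y; g \<in> hom C y z\<rbrakk>
      \<Longrightarrow> farr F (g \<cdot>\<^bsub>C\<^esub> f) = farr F g \<cdot>\<^bsub>D\<^esub> farr F f"

definition id_functor :: "('o, 'a, 'o, 'a) cfunctor" where
  "id_functor = \<lparr>fobj = (\<lambda>x. x), farr = (\<lambda>f. f)\<rparr>"

definition comp_functor ::
  "('p, 'b, 'q, 'c) cfunctor \<Rightarrow> ('o, 'a, 'p, 'b) cfunctor \<Rightarrow> ('o, 'a, 'q, 'c) cfunctor"
  (infixr "\<circ>\<^sub>F" 55) where
  "G \<circ>\<^sub>F F = \<lparr>fobj = (\<lambda>x. fobj G (fobj F x)), farr = (\<lambda>f. farr G (farr F f))\<rparr>"

text \<open>Functors are total HOL functions, so two of them are identified when they agree on the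
  objects and arrows of the source category.\<close>

definition functor_eq ::
  "('o, 'a) category \<Rightarrow> ('o, 'a, 'p, 'b) cfunctor \<Rightarrow> ('o, 'a, 'p, 'b) cfunctor \<Rightarrow> bool" where
  "functor_eq C F G \<longleftrightarrow>
    (\<forall>x\<in>Obj C. fobj F x = fobj G x) \<and> (\<forall>f\<in>Arr C. farr F f = farr G f)"

definition category_isomorphism ::
  "('o, 'a) category \<Rightarrow> ('p, 'b) category \<Rightarrow> ('o, 'a, 'p, 'b) cfunctor \<Rightarrow> bool" where
  "category_isomorphism C D F \<longleftrightarrow> cat_functor C D F \<and>
    (\<exists>G. cat_functor D C G \<and>
      functor_eq C (G \<circ>\<^sub>F F) id_functor \<and> functor_eq D (F \<circ>\<^sub>F G) id_functor)"

locale nat_trans = F: cat_functor C D F + G: cat_functor C D G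
  for C :: "('o, 'a) category" and D :: "('p, 'b) category"
    and F G :: "('o, 'a, 'p, 'b) cfunctor" +
  fixes t :: "'o \<Rightarrow> 'b"
  assumes component: "x \<in> Obj C \<Longrightarrow> t x \<in> hom D (fobj F x) (fobj G x)"
    and naturality: "f \<in> hom C x y \<Longrightarrow> t y \<cdot>\<^bsub>D\<^esub> farr F f = farr G f \<cdot>\<^bsub>D\<^esub> t x"


section \<open>Weak monads, weak comonads and weak Frobenius monads\<close>

text \<open>Identities between natural transformations are stated at each object \<open>B\<close>: the component
  of \<open>Fm\<close> at \<open>B\<close> is \<open>farr F (m B)\<close>, that of \<open>mF\<close> is \<open>m (fobj F B)\<close>.\<close>

locale nonunital_monad = nat_trans C C "F \<circ>\<^sub>F F" F m
  for C :: "('o, 'a) category" (structure)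
    and F :: "('o, 'a, 'o, 'a) cfunctor" and m :: "'o \<Rightarrow> 'a" +
  assumes m_assoc: "B \<in> Obj C \<Longrightarrow> m B \<cdot> farr F (m B) = m B \<cdot> m (fobj F B)"

locale weak_monad = nonunital_monad C F m + unit: nat_trans C C id_functor F \<eta>
  for C :: "('o, 'a) category" (structure)
    and F :: "('o, 'a, 'o, 'a) cfunctor" and m \<eta> :: "'o \<Rightarrow> 'a" +
  assumes unit_idem: "B \<in> Obj C \<Longrightarrow> \<eta> B = m B \<cdot> farr F (\<eta> B) \<cdot> \<eta> B"
    and m_unit: "B \<in> Obj C \<Longrightarrow> m B = m B \<cdot> m (fobj F B) \<cdot> farr F (\<eta> (fobj F B))"
    and unit_comm: "B \<in> Obj C \<Longrightarrow> m B \<cdot> farr F (\<eta> B) = m B \<cdot> \<eta> (fobj F B)"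

locale noncounital_comonad = nat_trans C C F "F \<circ>\<^sub>F F" \<delta>
  for C :: "('o, 'a) category" (structure)
    and F :: "('o, 'a, 'o, 'a) cfunctor" and \<delta> :: "'o \<Rightarrow> 'a" +
  assumes \<delta>_coassoc: "B \<in> Obj C \<Longrightarrow> farr F (\<delta> B) \<cdot> \<delta> B = \<delta> (fobj F B) \<cdot> \<delta> B"

locale weak_comonad = noncounital_comonad C F \<delta> + counit: nat_trans C C F id_functor \<epsilon>
  for C :: "('o, 'a) category" (structure)
    and F :: "('o, 'a, 'o, 'a) cfunctor" and \<delta> \<epsilon> :: "'o \<Rightarrow> 'a" +
  assumes counit_idem: "B \<in> Obj C \<Longrightarrow> \<epsilon> B = \<epsilon> B \<cdot> farr F (\<epsilon> B) \<cdot> \<delta> B"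
    and \<delta>_counit: "B \<in> Obj C \<Longrightarrow> \<delta> B = farr F (\<epsilon> (fobj F B)) \<cdot> farr F (\<delta> B) \<cdot> \<delta> B"
    and counit_comm: "B \<in> Obj C \<Longrightarrow> farr F (\<epsilon> B) \<cdot> \<delta> B = \<epsilon> (fobj F B) \<cdot> \<delta> B"

locale weak_Frobenius_monad = weak_monad C F m \<eta> + weak_comonad C F \<delta> \<epsilon>
  for C :: "('o, 'a) category" (structure)
    and F :: "('o, 'a, 'o, 'a) cfunctor" and m \<eta> \<delta> \<epsilon> :: "'o \<Rightarrow> 'a" +
  assumes Frobenius_left: "B \<in> Obj C \<Longrightarrow> farr F (m B) \<cdot> \<delta> (fobj F B) = \<delta> B \<cdot> m B"
    and Frobenius_right: "B \<in> Obj C \<Longrightarrow> \<delta> B \<cdot> m B = m (fobj F B) \<cdot> farr F (\<delta> B)"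
    and unit_counit: "B \<in> Obj C \<Longrightarrow> m B \<cdot> farr F (\<eta> B) = farr F (\<epsilon> B) \<cdot> \<delta> B"


section \<open>Modules, comodules and Frobenius bimodules\<close>

context
  fixes C :: "('o, 'a) category" (structure) and F :: "('o, 'a, 'o, 'a) cfunctor"
begin

definition nonunital_module :: "('o \<Rightarrow> 'a) \<Rightarrow> 'o \<times> 'a \<Rightarrow> bool" where
  "nonunital_module m = (\<lambda>(B, \<rho>).
    B \<in> Obj C \<and> \<rho> \<in> hom C (fobj F B) B \<and> \<rho> \<cdot> farr F \<rho> = \<rho> \<cdot> m B)"

definition compatible_module :: "('o \<Rightarrow> 'a) \<Rightarrow> ('o \<Rightarrow> 'a) \<Rightarrow> 'o \<times> 'a \<Rightarrow> bool" where
  "compatible_module m \<eta> = (\<lambda>(B, \<rho>).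
    nonunital_module m (B, \<rho>) \<and> \<rho> = \<rho> \<cdot> m B \<cdot> farr F (\<eta> B))"

definition module_morphism :: "'o \<times> 'a \<Rightarrow> 'o \<times> 'a \<Rightarrow> 'a \<Rightarrow> bool" where
  "module_morphism = (\<lambda>(B, \<rho>) (B', \<rho>') f. f \<in> hom C B B' \<and> f \<cdot> \<rho> = \<rho>' \<cdot> farr F f)"

definition noncounital_comodule :: "('o \<Rightarrow> 'a) \<Rightarrow> 'o \<times> 'a \<Rightarrow> bool" where
  "noncounital_comodule \<delta> = (\<lambda>(B, \<omega>).
    B \<in> Obj C \<and> \<omega> \<in> hom C B (fobj F B) \<and> farr F \<omega> \<cdot> \<omega> = \<delta> B \<cdot> \<omega>)"

definition compatible_comodule :: "('o \<Rightarrow> 'a) \<Rightarrow> ('o \<Rightarrow> 'a) \<Rightarrow> 'o \<times> 'a \<Rightarrow> bool" where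
  "compatible_comodule \<delta> \<epsilon> = (\<lambda>(B, \<omega>).
    noncounital_comodule \<delta> (B, \<omega>) \<and> \<omega> = farr F (\<epsilon> B) \<cdot> \<delta> B \<cdot> \<omega>)"

definition comodule_morphism :: "'o \<times> 'a \<Rightarrow> 'o \<times> 'a \<Rightarrow> 'a \<Rightarrow> bool" where
  "comodule_morphism = (\<lambda>(B, \<omega>) (B', \<omega>') f. f \<in> hom C B B' \<and> \<omega>' \<cdot> f = farr F f \<cdot> \<omega>)"

definition Frobenius_bimodule :: "('o \<Rightarrow> 'a) \<Rightarrow> ('o \<Rightarrow> 'a) \<Rightarrow> 'o \<times> 'a \<times> 'a \<Rightarrow> bool" where
  "Frobenius_bimodule m \<delta> = (\<lambda>(B, \<rho>, \<omega>).
    nonunital_module m (B, \<rho>) \<and> noncounital_comodule \<delta> (B, \<omega>) \<and>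
    farr F \<rho> \<cdot> \<delta> B = \<omega> \<cdot> \<rho> \<and> \<omega> \<cdot> \<rho> = m B \<cdot> farr F \<omega>)"

end

text \<open>The category of structured objects \<open>s\<close> satisfying \<open>P\<close>, whose morphisms from \<open>s\<close> to \<open>s'\<close>
  are the morphisms \<open>f\<close> of the base category \<open>C\<close> with \<open>Q s s' f\<close>. The same \<open>f\<close> may be a morphism
  between several pairs of structured objects, so arrows are triples \<open>(s, f, s')\<close> recording
  domain and codomain; \<open>U\<close> gives the underlying object, used for the identities.\<close>

definition structured_category ::
  "('o, 'a) category \<Rightarrow> ('s \<Rightarrow> 'o) \<Rightarrow> ('s \<Rightarrow> bool) \<Rightarrow> ('s \<Rightarrow> 's \<Rightarrow> 'a \<Rightarrow> bool)
    \<Rightarrow> ('s, 's \<times> 'a \<times> 's) category" where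
  "structured_category C U P Q =
    \<lparr>Obj = {s. P s},
     Arr = {(s, f, s'). P s \<and> P s' \<and> Q s s' f},
     Dom = (\<lambda>(s, f, s'). s),
     Cod = (\<lambda>(s, f, s'). s'),
     Id = (\<lambda>s. (s, Id C (U s), s)),
     Comp = (\<lambda>(_, g, s'') (s, f, _). (s, g \<cdot>\<^bsub>C\<^esub> f, s''))\<rparr>"

definition compatible_modules where
  "compatible_modules C F m \<eta> =
    structured_category C fst (compatible_module C F m \<eta>) (module_morphism C F)"

definition compatible_comodules where
  "compatible_comodules C F \<delta> \<epsilon> =
    structured_category C fst (compatible_comodule C F \<delta> \<epsilon>) (comodule_morphism C F)"

definition compatible_Frobenius_bimodules where
  "compatible_Frobenius_bimodules C F m \<eta> \<delta> \<epsilon> =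
    structured_category C fst
      (\<lambda>(B, \<rho>, \<omega>). Frobenius_bimodule C F m \<delta> (B, \<rho>, \<omega>) \<and>
        compatible_comodule C F \<delta> \<epsilon> (B, \<omega>) \<and> compatible_module C F m \<eta> (B, \<rho>))
      (\<lambda>(B, \<rho>, \<omega>) (B', \<rho>', \<omega>') f.
        module_morphism C F (B, \<rho>) (B', \<rho>') f \<and> comodule_morphism C F (B, \<omega>) (B', \<omega>') f)"

text \<open>Functors between categories of structured objects that are the identity on the underlying
  morphisms.\<close>

definition structured_functor ::
  "('s \<Rightarrow> 't) \<Rightarrow> ('s, 's \<times> 'a \<times> 's, 't, 't \<times> 'a \<times> 't) cfunctor" where
  "structured_functor T = \<lparr>fobj = T, farr = (\<lambda>(s, f, s'). (T s, f, T s'))\<rparr>"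

definition \<Psi> where
  "\<Psi> C F m \<epsilon> =
    structured_functor (\<lambda>(B, \<omega>). (B, \<epsilon> B \<cdot>\<^bsub>C\<^esub> m B \<cdot>\<^bsub>C\<^esub> farr F \<omega>, \<omega>))"

definition \<Phi> where
  "\<Phi> C F \<delta> \<eta> =
    structured_functor (\<lambda>(B, \<rho>). (B, \<rho>, farr F \<rho> \<cdot>\<^bsub>C\<^esub> \<delta> B \<cdot>\<^bsub>C\<^esub> \<eta> B))"

definition forget_comodule :: "('o \<times> 'a \<times> 'a, _, 'o \<times> 'a, _) cfunctor" where
  "forget_comodule = structured_functor (\<lambda>(B, \<rho>, \<omega>). (B, \<rho>))"

definition forget_module :: "('o \<times> 'a \<times> 'a, _, 'o \<times> 'a, _) cfunctor" where
  "forget_module = structured_functor (\<lambda>(B, \<rho>, \<omega>). (B, \<omega>))"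

end

theory Submission
  imports Defs
begin

text \<open>The natural endomorphism \<open>\<kappa> = m \<cdot> F\<eta> = F\<epsilon> \<cdot> \<delta>\<close> of \<open>F\<close> is absorbed by \<open>m\<close>
  and \<open>\<delta>\<close> on either side. For a compatible comodule \<open>(B, \<omega>)\<close> and \<open>\<rho> = \<epsilon> \<cdot> m \<cdot> F\<omega>\<close>, naturality
  and the Frobenius property bring both \<open>\<omega> \<cdot> \<rho>\<close> and \<open>F\<rho> \<cdot> \<delta>\<close> into the form \<open>\<kappa> \<cdot> m \<cdot> F\<omega>\<close>, which is
  \<open>m \<cdot> F\<omega>\<close>; the module laws follow, and dually for a compatible module. In a bimodule with both
  parts compatible, \<open>\<epsilon> \<cdot> m \<cdot> F\<omega> = \<epsilon> \<cdot> F\<rho> \<cdot> \<delta> = \<rho> \<cdot> \<kappa> = \<rho>\<close> and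
  \<open>F\<rho> \<cdot> \<delta> \<cdot> \<eta> = m \<cdot> F\<omega> \<cdot> \<eta> = \<kappa> \<cdot> \<omega> = \<omega>\<close>, so each structure determines the other.\<close>

section \<open>Categories of structured objects\<close>

text \<open>Associativity and the identity laws are inherited from \<open>C\<close>, because
  composition acts on the middle entry of each triple. What remains is that \<open>Q\<close>
  contains the identities and is closed under composition.\<close>

lemma category_structured_category:
  assumes "category C"
    and "\<And>s. P s \<Longrightarrow> U s \<in> Obj C"
    and Q_hom: "\<And>s s' f. P s \<Longrightarrow> P s' \<Longrightarrow> Q s s' f \<Longrightarrow> f \<in> hom C (U s) (U s')"
    and "\<And>s. P s \<Longrightarrow> Q s s (Id C (U s))"
    and "\<And>s s' s'' f g. P s \<Longrightarrow> P s' \<Longrightarrow> P s'' \<Longrightarrow> Q s s' f \<Longrightarrow> Q s' s'' g \<Longrightarrow> Q s s'' (g \<cdot>\<^bsub>C\<^esub> f)"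
  shows "category (structured_category C U P Q)"
proof -
  interpret category C by fact
  \<comment> \<open>\<open>hom_def\<close> is instantiated at record terms, so only homs of the new
    category unfold. Homs of \<open>C\<close> stay folded and match the premises of the category
    laws.\<close>
  show ?thesis
    by unfold_locales
      (auto simp: structured_category_def hom_def[of "\<lparr>Obj = _, Arr = _, Dom = _, Cod = _, Id = _, Comp = _\<rparr>"]
        intro: assms id_left id_right assoc dest: Q_hom)
qed

text \<open>The identity at \<open>s\<close> carries \<open>Id C (U s)\<close>, so preservation of
  identities is exactly the condition \<open>U' (T s) = U s\<close>.\<close>

lemma cat_functor_structured_functor:
  assumes "category (structured_category C U P Q)" "category (structured_category C U' P' Q')"
    and "\<And>s. P s \<Longrightarrow> P' (T s)"
    and "\<And>s. P s \<Longrightarrow> U' (T s) = U s"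
    and "\<And>s s' f. P s \<Longrightarrow> P s' \<Longrightarrow> Q s s' f \<Longrightarrow> Q' (T s) (T s') f"
  shows "cat_functor (structured_category C U P Q) (structured_category C U' P' Q')
    (structured_functor T)"
  using assms
  by (auto simp: cat_functor_def cat_functor_axioms_def structured_category_def
      structured_functor_def hom_def)

lemma structured_functor_comp:
  "structured_functor S \<circ>\<^sub>F structured_functor T = structured_functor (\<lambda>s. S (T s))"
  by (auto simp: structured_functor_def comp_functor_def)

lemma functor_eq_structured_functor_id:
  assumes "\<And>s. P s \<Longrightarrow> T s = s"
  shows "functor_eq (structured_category C U P Q) (structured_functor T) id_functor"
  using assms
  by (auto simp: functor_eq_def structured_functor_def id_functor_def structured_category_def)

lemma category_isomorphismI:
  assumes "cat_functor C D F" "cat_functor D C G"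
    and "functor_eq C (G \<circ>\<^sub>F F) id_functor" "functor_eq D (F \<circ>\<^sub>F G) id_functor"
  shows "category_isomorphism C D F"
  using assms unfolding category_isomorphism_def by blast

lemma cat_functor_comp:
  assumes "cat_functor C D F" "cat_functor D E G"
  shows "cat_functor C E (G \<circ>\<^sub>F F)"
proof -
  interpret F: cat_functor C D F by fact
  interpret G: cat_functor D E G by fact
  show ?thesis
    by unfold_locales
      (auto simp: comp_functor_def F.farr_id G.farr_id[OF F.fobj_obj] F.farr_comp G.farr_comp[OF F.farr_hom F.farr_hom]
        intro: F.fobj_obj G.fobj_obj F.farr_hom G.farr_hom)
qed

lemma category_isomorphism_comp:
  assumes "category_isomorphism C D F" "category_isomorphism D E G"
  shows "category_isomorphism C E (G \<circ>\<^sub>F F)"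
proof -
  obtain F' where F: "cat_functor C D F" "cat_functor D C F'"
      "functor_eq C (F' \<circ>\<^sub>F F) id_functor" "functor_eq D (F \<circ>\<^sub>F F') id_functor"
    using assms(1) unfolding category_isomorphism_def by blast
  obtain G' where G: "cat_functor D E G" "cat_functor E D G'"
      "functor_eq D (G' \<circ>\<^sub>F G) id_functor" "functor_eq E (G \<circ>\<^sub>F G') id_functor"
    using assms(2) unfolding category_isomorphism_def by blast
  \<comment> \<open>\<open>functor_eq\<close> constrains values only on the objects and arrows of
    its source. Cancelling an inner inverse pair therefore needs the intermediate arrow to lie in
    \<open>D\<close>.\<close>
  have F_arr: "farr F f \<in> Arr D" if "f \<in> Arr C" for f
    using cat_functor.farr_hom[OF F(1)] that by (fastforce simp: hom_def)
  have G'_arr: "farr G' f \<in> Arr D" if "f \<in> Arr E" for f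
    using cat_functor.farr_hom[OF G(2)] that by (fastforce simp: hom_def)
  show ?thesis
  proof (rule category_isomorphismI)
    show "functor_eq C ((F' \<circ>\<^sub>F G') \<circ>\<^sub>F (G \<circ>\<^sub>F F)) id_functor"
      using F(3) G(3) F_arr cat_functor.fobj_obj[OF F(1)]
      by (auto simp: functor_eq_def comp_functor_def id_functor_def)
    show "functor_eq E ((G \<circ>\<^sub>F F) \<circ>\<^sub>F (F' \<circ>\<^sub>F G')) id_functor"
      using F(4) G(4) G'_arr cat_functor.fobj_obj[OF G(2)]
      by (auto simp: functor_eq_def comp_functor_def id_functor_def)
  qed (use F G cat_functor_comp in blast)+
qed

section \<open>Weak Frobenius monads\<close>

context category
begin

text \<open>Stated with \<open>Dom\<close> and \<open>Cod\<close> instead of \<open>hom\<close>, so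
  that composability becomes an equation the simplifier can decide without guessing intermediate
  objects.\<close>

lemma comp_arr:
  assumes "f \<in> Arr C" "g \<in> Arr C" "Cod C f = Dom C g"
  shows "g \<cdot> f \<in> Arr C" "Dom C (g \<cdot> f) = Dom C f" "Cod C (g \<cdot> f) = Cod C g"
  using comp_hom[of f "Dom C f" "Dom C g" g "Cod C g"] assms by (auto simp: hom_def)

lemma assoc_arr:
  assumes "f \<in> Arr C" "g \<in> Arr C" "h \<in> Arr C" "Cod C f = Dom C g" "Cod C g = Dom C h"
  shows "(h \<cdot> g) \<cdot> f = h \<cdot> g \<cdot> f"
  using assms by (intro assoc) (auto simp: hom_def)

text \<open>In a right-nested chain \<open>a \<cdot> b \<cdot> h\<close> the composite
  \<open>a \<cdot> b\<close> is not a subterm; this form lets an equation for it be used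
  there.\<close>

lemma comp_eq_extend:
  assumes "a \<cdot> b = k" "h \<in> Arr C" "b \<in> Arr C" "a \<in> Arr C" "Cod C h = Dom C b" "Cod C b = Dom C a"
  shows "a \<cdot> b \<cdot> h = k \<cdot> h"
  using assms assoc_arr by metis

end

section \<open>The functor and its four natural transformations\<close>

context weak_Frobenius_monad
begin

text \<open>Singles out the functor laws of \<open>F\<close> itself: the qualifier \<open>F\<close>
  inherited from \<open>nat_trans\<close> also names the source \<open>F \<circ>\<^sub>F F\<close>
  of \<open>m\<close>.\<close>

lemma functor_F: "cat_functor C C F"
  by unfold_locales

lemma F_obj [simp]: "B \<in> Obj C \<Longrightarrow> fobj F B \<in> Obj C"
  using cat_functor.fobj_obj[OF functor_F] .

lemma F_arr [simp]:
  assumes "f \<in> Arr C"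
  shows "farr F f \<in> Arr C" "Dom C (farr F f) = fobj F (Dom C f)" "Cod C (farr F f) = fobj F (Cod C f)"
  using cat_functor.farr_hom[OF functor_F, of f "Dom C f" "Cod C f"] assms by (auto simp: hom_def)

lemma F_comp:
  assumes "f \<in> Arr C" "g \<in> Arr C" "Cod C f = Dom C g"
  shows "farr F (g \<cdot> f) = farr F g \<cdot> farr F f"
  using cat_functor.farr_comp[OF functor_F] assms by (auto simp: hom_def)

lemma component_arr [simp]:
  assumes "B \<in> Obj C"
  shows "m B \<in> Arr C" "Dom C (m B) = fobj F (fobj F B)" "Cod C (m B) = fobj F B"
    and "\<eta> B \<in> Arr C" "Dom C (\<eta> B) = B" "Cod C (\<eta> B) = fobj F B"
    and "\<delta> B \<in> Arr C" "Dom C (\<delta> B) = fobj F B" "Cod C (\<delta> B) = fobj F (fobj F B)"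
    and "\<epsilon> B \<in> Arr C" "Dom C (\<epsilon> B) = fobj F B" "Cod C (\<epsilon> B) = B"
  using nat_trans.component[OF nonunital_monad.axioms(1)[OF nonunital_monad_axioms], OF assms] unit.component[OF assms]
    nat_trans.component[OF noncounital_comonad.axioms(1)[OF noncounital_comonad_axioms], OF assms]
    counit.component[OF assms]
  by (auto simp: hom_def comp_functor_def id_functor_def)

text \<open>The codomain is a separate variable tied by \<open>Cod C f = B\<close>, so that the left
  sides match components at any term for the object.\<close>

lemma naturality_arr:
  assumes "f \<in> Arr C" "Cod C f = B"
  shows m_nat: "m B \<cdot> farr F (farr F f) = farr F f \<cdot> m (Dom C f)"
    and unit_nat: "\<eta> B \<cdot> f = farr F f \<cdot> \<eta> (Dom C f)"
    and \<delta>_nat: "\<delta> B \<cdot> farr F f = farr F (farr F f) \<cdot> \<delta> (Dom C f)"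
    and counit_nat: "\<epsilon> B \<cdot> farr F f = f \<cdot> \<epsilon> (Dom C f)"
proof -
  have f: "f \<in> hom C (Dom C f) B" using assms by (simp add: hom_def)
  show "m B \<cdot> farr F (farr F f) = farr F f \<cdot> m (Dom C f)" "\<eta> B \<cdot> f = farr F f \<cdot> \<eta> (Dom C f)"
    "\<delta> B \<cdot> farr F f = farr F (farr F f) \<cdot> \<delta> (Dom C f)" "\<epsilon> B \<cdot> farr F f = f \<cdot> \<epsilon> (Dom C f)"
    using nat_trans.naturality[OF nonunital_monad.axioms(1)[OF nonunital_monad_axioms], OF f] unit.naturality[OF f]
      nat_trans.naturality[OF noncounital_comonad.axioms(1)[OF noncounital_comonad_axioms], OF f]
      counit.naturality[OF f]
    by (simp_all add: comp_functor_def id_functor_def)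
qed


lemmas [simp] = F.source.dom_obj F.source.cod_obj
lemmas comp_simps = F.source.comp_arr F.source.assoc_arr F_comp
lemmas comp_eq_extend = F.source.comp_eq_extend

section \<open>The natural endomorphism \<kappa> of the functor\<close>

definition \<kappa> :: "'o \<Rightarrow> 'a" where
  "\<kappa> B = m B \<cdot> farr F (\<eta> B)"

lemma \<kappa>_arr [simp]:
  assumes "B \<in> Obj C"
  shows "\<kappa> B \<in> Arr C" "Dom C (\<kappa> B) = fobj F B" "Cod C (\<kappa> B) = fobj F B"
  using assms by (simp_all add: \<kappa>_def comp_simps)

lemma
  assumes "B \<in> Obj C"
  shows \<kappa>_unit: "\<kappa> B = m B \<cdot> \<eta> (fobj F B)"
    and \<kappa>_counit_left: "\<kappa> B = farr F (\<epsilon> B) \<cdot> \<delta> B"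
    and \<kappa>_counit_right: "\<kappa> B = \<epsilon> (fobj F B) \<cdot> \<delta> B"
  using assms unit_comm unit_counit counit_comm by (simp_all add: \<kappa>_def)

text \<open>In the form \<open>F\<epsilon> \<cdot> \<delta>\<close>, the arrow
  \<open>farr F f\<close> slides through \<open>\<delta>\<close> and then, under \<open>F\<close>,
  through \<open>\<epsilon>\<close>.\<close>

lemma \<kappa>_nat:
  assumes "f \<in> Arr C" "Cod C f = B"
  shows "\<kappa> B \<cdot> farr F f = farr F f \<cdot> \<kappa> (Dom C f)"
proof -
  have obj: "B \<in> Obj C" "Dom C f \<in> Obj C" using assms by auto
  then have "\<kappa> B \<cdot> farr F f = farr F (\<epsilon> B) \<cdot> \<delta> B \<cdot> farr F f"
    using assms by (simp add: \<kappa>_counit_left comp_simps)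
  also have "\<dots> = farr F (\<epsilon> B \<cdot> farr F f) \<cdot> \<delta> (Dom C f)"
    using assms obj by (simp add: \<delta>_nat comp_simps)
  also have "\<dots> = farr F f \<cdot> \<kappa> (Dom C f)"
    using assms obj by (simp add: counit_nat \<kappa>_counit_left comp_simps)
  finally show ?thesis .
qed

lemma m_\<kappa>:
  assumes "B \<in> Obj C"
  shows "m B \<cdot> \<kappa> (fobj F B) = m B"
  using m_unit[OF assms] by (simp add: \<kappa>_def)

text \<open>With \<kappa> written as \<open>m \<cdot> \<eta>F\<close>, naturality of
  \<open>\<eta>\<close> at \<open>m B\<close> followed by associativity moves \<kappa> to the other
  side of \<open>m\<close>, where the weak monad axiom absorbs it.\<close>

lemma \<kappa>_m:
  assumes "B \<in> Obj C"
  shows "\<kappa> B \<cdot> m B = m B"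
proof -
  have "\<kappa> B \<cdot> m B = m B \<cdot> \<eta> (fobj F B) \<cdot> m B"
    using assms by (simp add: \<kappa>_unit comp_simps)
  also have "\<dots> = m B \<cdot> farr F (m B) \<cdot> \<eta> (fobj F (fobj F B))"
    using assms unit_nat[of "m B"] by simp
  also have "\<dots> = m B \<cdot> m (fobj F B) \<cdot> \<eta> (fobj F (fobj F B))"
    using assms by (simp add: comp_eq_extend[OF m_assoc] comp_simps)
  also have "\<dots> = m B"
    using assms m_\<kappa> by (simp flip: \<kappa>_unit)
  finally show ?thesis .
qed

text \<open>Coassociativity turns \<open>F\<delta> \<cdot> \<delta>\<close> in the weak comonad
  axiom into \<open>\<delta>F \<cdot> \<delta>\<close>, which exposes \<kappa>.\<close>

lemma \<kappa>_\<delta>: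
  assumes "B \<in> Obj C"
  shows "\<kappa> (fobj F B) \<cdot> \<delta> B = \<delta> B"
  using assms \<delta>_counit[of B] by (simp add: \<kappa>_counit_left \<delta>_coassoc comp_simps)

text \<open>Dual to \<open>\<kappa>_m\<close>: naturality of \<open>\<epsilon>\<close> at
  \<open>\<delta> B\<close> and coassociativity carry \<kappa> across
  \<open>\<delta>\<close>.\<close>

lemma \<delta>_\<kappa>:
  assumes "B \<in> Obj C"
  shows "\<delta> B \<cdot> \<kappa> B = \<delta> B"
proof -
  have "\<delta> B \<cdot> \<kappa> B = (\<delta> B \<cdot> \<epsilon> (fobj F B)) \<cdot> \<delta> B"
    using assms by (simp add: \<kappa>_counit_right comp_simps)
  also have "\<dots> = \<epsilon> (fobj F (fobj F B)) \<cdot> farr F (\<delta> B) \<cdot> \<delta> B"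
    using assms counit_nat[of "\<delta> B"] by (simp flip: F.source.assoc_arr)
  also have "\<dots> = \<kappa> (fobj F B) \<cdot> \<delta> B"
    using assms by (simp add: \<delta>_coassoc \<kappa>_counit_right comp_simps)
  finally show ?thesis using assms by (simp add: \<kappa>_\<delta>)
qed

section \<open>Compatible structures, the bimodules they determine, and their morphisms\<close>

lemma compatible_moduleD:
  assumes "compatible_module C F m \<eta> (B, \<rho>)"
  shows "B \<in> Obj C" "\<rho> \<in> Arr C" "Dom C \<rho> = fobj F B" "Cod C \<rho> = B"
    and "\<rho> \<cdot> farr F \<rho> = \<rho> \<cdot> m B" "\<rho> \<cdot> \<kappa> B = \<rho>"
  using assms by (auto simp: compatible_module_def nonunital_module_def hom_def \<kappa>_def)

text \<open>The counit form of \<kappa> turns compatibility of a comodule into absorption of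
  \<kappa> on the left, just as its definition gives absorption on the right for a module.\<close>

lemma compatible_comoduleD:
  assumes "compatible_comodule C F \<delta> \<epsilon> (B, \<omega>)"
  shows "B \<in> Obj C" "\<omega> \<in> Arr C" "Dom C \<omega> = B" "Cod C \<omega> = fobj F B"
    and "farr F \<omega> \<cdot> \<omega> = \<delta> B \<cdot> \<omega>" "\<kappa> B \<cdot> \<omega> = \<omega>"
  using assms
  by (auto simp: compatible_comodule_def noncounital_comodule_def hom_def \<kappa>_counit_left comp_simps)

definition compatible_bimodule :: "'o \<times> 'a \<times> 'a \<Rightarrow> bool" where
  "compatible_bimodule = (\<lambda>(B, \<rho>, \<omega>). Frobenius_bimodule C F m \<delta> (B, \<rho>, \<omega>) \<and>
    compatible_comodule C F \<delta> \<epsilon> (B, \<omega>) \<and> compatible_module C F m \<eta> (B, \<rho>))"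

lemma compatible_bimoduleI:
  assumes "B \<in> Obj C" "\<rho> \<in> Arr C" "Dom C \<rho> = fobj F B" "Cod C \<rho> = B"
    and "\<omega> \<in> Arr C" "Dom C \<omega> = B" "Cod C \<omega> = fobj F B"
    and "\<rho> \<cdot> farr F \<rho> = \<rho> \<cdot> m B" "\<rho> \<cdot> \<kappa> B = \<rho>"
    and "farr F \<omega> \<cdot> \<omega> = \<delta> B \<cdot> \<omega>" "\<kappa> B \<cdot> \<omega> = \<omega>"
    and "farr F \<rho> \<cdot> \<delta> B = \<omega> \<cdot> \<rho>" "\<omega> \<cdot> \<rho> = m B \<cdot> farr F \<omega>"
  shows "compatible_bimodule (B, \<rho>, \<omega>)"
  using assms \<kappa>_counit_left[of B] \<kappa>_def[of B] F.source.assoc_arr[of \<omega> "\<delta> B" "farr F (\<epsilon> B)"]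
  by (simp add: compatible_bimodule_def Frobenius_bimodule_def compatible_comodule_def
      noncounital_comodule_def compatible_module_def nonunital_module_def hom_def)

lemma compatible_bimodule_of_comodule:
  assumes "compatible_comodule C F \<delta> \<epsilon> (B, \<omega>)"
  shows "compatible_bimodule (B, \<epsilon> B \<cdot> m B \<cdot> farr F \<omega>, \<omega>)"
proof -
  note \<omega> [simp] = compatible_comoduleD[OF assms]
  define \<rho> where "\<rho> = \<epsilon> B \<cdot> m B \<cdot> farr F \<omega>"
  have \<rho>_arr [simp]: "\<rho> \<in> Arr C" "Dom C \<rho> = fobj F B" "Cod C \<rho> = B"
    by (simp_all add: \<rho>_def comp_simps)
  have "\<omega> \<cdot> \<rho> = (\<omega> \<cdot> \<epsilon> B) \<cdot> m B \<cdot> farr F \<omega>"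
    by (simp add: \<rho>_def comp_simps)
  also have "\<dots> = (\<epsilon> (fobj F B) \<cdot> farr F \<omega>) \<cdot> m B \<cdot> farr F \<omega>"
    by (simp add: counit_nat)
  also have "\<dots> = \<epsilon> (fobj F B) \<cdot> (farr F \<omega> \<cdot> m B) \<cdot> farr F \<omega>"
    by (simp add: comp_simps)
  also have "\<dots> = \<epsilon> (fobj F B) \<cdot> (m (fobj F B) \<cdot> farr F (farr F \<omega>)) \<cdot> farr F \<omega>"
    by (simp add: m_nat)
  \<comment> \<open>The comodule law is switched off here so that functoriality can expand
    \<open>farr F \<omega> \<cdot> \<omega>\<close> under \<open>F\<close>; the next step rewrites
    it to \<open>\<delta> B \<cdot> \<omega>\<close>.\<close>
  also have "\<dots> = \<epsilon> (fobj F B) \<cdot> m (fobj F B) \<cdot> farr F (farr F \<omega> \<cdot> \<omega>)"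
    by (simp add: comp_simps del: \<omega>(5))
  also have "\<dots> = \<epsilon> (fobj F B) \<cdot> (m (fobj F B) \<cdot> farr F (\<delta> B)) \<cdot> farr F \<omega>"
    by (simp add: comp_simps)
  \<comment> \<open>The Frobenius property trades \<open>mF \<cdot> F\<delta>\<close> for
    \<open>\<delta> \<cdot> m\<close>, and \<open>\<epsilon>F \<cdot> \<delta>\<close> is
    \<kappa>.\<close>
  also have "\<dots> = \<kappa> B \<cdot> m B \<cdot> farr F \<omega>"
    by (simp add: Frobenius_right[symmetric] \<kappa>_counit_right comp_simps)
  also have "\<dots> = m B \<cdot> farr F \<omega>"
    by (simp add: comp_eq_extend[OF \<kappa>_m])
  finally have \<omega>\<rho>: "\<omega> \<cdot> \<rho> = m B \<cdot> farr F \<omega>" .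
  have "farr F \<rho> \<cdot> \<delta> B = farr F (\<epsilon> B) \<cdot> farr F (m B) \<cdot> farr F (farr F \<omega>) \<cdot> \<delta> B"
    by (simp add: \<rho>_def comp_simps)
  also have "\<dots> = farr F (\<epsilon> B) \<cdot> (farr F (m B) \<cdot> \<delta> (fobj F B)) \<cdot> farr F \<omega>"
    by (simp add: \<delta>_nat comp_simps)
  also have "\<dots> = \<kappa> B \<cdot> m B \<cdot> farr F \<omega>"
    by (simp add: Frobenius_left \<kappa>_counit_left comp_simps)
  also have "\<dots> = m B \<cdot> farr F \<omega>"
    by (simp add: comp_eq_extend[OF \<kappa>_m])
  finally have F\<rho>\<delta>: "farr F \<rho> \<cdot> \<delta> B = \<omega> \<cdot> \<rho>" by (simp add: \<omega>\<rho>)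
  \<comment> \<open>Only the outer \<open>\<rho>\<close> is unfolded, so that
    \<open>\<omega> \<cdot> \<rho>\<close> forms under \<open>F\<close> and can be replaced by
    \<open>m B \<cdot> farr F \<omega>\<close>.\<close>
  have "\<rho> \<cdot> farr F \<rho> = \<epsilon> B \<cdot> m B \<cdot> farr F (\<omega> \<cdot> \<rho>)"
    by (subst \<rho>_def) (simp add: comp_simps)
  also have "\<dots> = \<epsilon> B \<cdot> (m B \<cdot> farr F (m B)) \<cdot> farr F (farr F \<omega>)"
    by (simp add: \<omega>\<rho> comp_simps)
  also have "\<dots> = \<epsilon> B \<cdot> m B \<cdot> m (fobj F B) \<cdot> farr F (farr F \<omega>)"
    by (simp add: m_assoc comp_simps)
  also have "\<dots> = \<rho> \<cdot> m B"
    by (simp add: m_nat \<rho>_def comp_simps)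
  finally have \<rho>_mod: "\<rho> \<cdot> farr F \<rho> = \<rho> \<cdot> m B" .
  \<comment> \<open>Naturality carries \<kappa> past \<open>farr F \<omega>\<close> to
    \<open>m B\<close>, which absorbs it.\<close>
  have "\<rho> \<cdot> \<kappa> B = \<epsilon> B \<cdot> m B \<cdot> farr F \<omega> \<cdot> \<kappa> B"
    by (simp add: \<rho>_def comp_simps)
  also have "\<dots> = \<epsilon> B \<cdot> (m B \<cdot> \<kappa> (fobj F B)) \<cdot> farr F \<omega>"
    using \<kappa>_nat[of \<omega>] by (simp add: comp_simps)
  also have "\<dots> = \<rho>"
    by (simp add: m_\<kappa> \<rho>_def)
  finally have "\<rho> \<cdot> \<kappa> B = \<rho>" .
  with \<omega>\<rho> F\<rho>\<delta> \<rho>_mod have "compatible_bimodule (B, \<rho>, \<omega>)"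
    by (intro compatible_bimoduleI) simp_all
  then show ?thesis by (simp add: \<rho>_def)
qed

text \<open>Dual to the comodule case: \<open>\<omega> \<cdot> \<rho>\<close> and
  \<open>m B \<cdot> farr F \<omega>\<close> both reduce to
  \<open>farr F \<rho> \<cdot> \<delta> B \<cdot> \<kappa> B\<close>, with \<kappa> arising as
  \<open>m \<cdot> \<eta>F\<close> and as \<open>m \<cdot> F\<eta>\<close> respectively, and
  \<open>\<delta>\<close> absorbs \<kappa>.\<close>

lemma compatible_bimodule_of_module:
  assumes "compatible_module C F m \<eta> (B, \<rho>)"
  shows "compatible_bimodule (B, \<rho>, farr F \<rho> \<cdot> \<delta> B \<cdot> \<eta> B)"
proof -
  note \<rho> [simp] = compatible_moduleD[OF assms]
  define \<omega> where "\<omega> = farr F \<rho> \<cdot> \<delta> B \<cdot> \<eta> B"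
  have \<omega>_arr [simp]: "\<omega> \<in> Arr C" "Dom C \<omega> = B" "Cod C \<omega> = fobj F B"
    by (simp_all add: \<omega>_def comp_simps)
  have "\<omega> \<cdot> \<rho> = farr F \<rho> \<cdot> \<delta> B \<cdot> \<eta> B \<cdot> \<rho>"
    by (simp add: \<omega>_def comp_simps)
  also have "\<dots> = farr F \<rho> \<cdot> (\<delta> B \<cdot> farr F \<rho>) \<cdot> \<eta> (fobj F B)"
    using unit_nat[of \<rho>] by (simp add: comp_simps)
  also have "\<dots> = farr F (\<rho> \<cdot> farr F \<rho>) \<cdot> \<delta> (fobj F B) \<cdot> \<eta> (fobj F B)"
    by (simp add: \<delta>_nat comp_simps del: \<rho>(5))
  also have "\<dots> = farr F \<rho> \<cdot> (farr F (m B) \<cdot> \<delta> (fobj F B)) \<cdot> \<eta> (fobj F B)"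
    by (simp add: comp_simps)
  also have "\<dots> = farr F \<rho> \<cdot> \<delta> B \<cdot> \<kappa> B"
    by (simp add: Frobenius_left \<kappa>_unit comp_simps)
  finally have \<omega>\<rho>: "farr F \<rho> \<cdot> \<delta> B = \<omega> \<cdot> \<rho>" by (simp add: \<delta>_\<kappa>)
  have "m B \<cdot> farr F \<omega> = (m B \<cdot> farr F (farr F \<rho>)) \<cdot> farr F (\<delta> B) \<cdot> farr F (\<eta> B)"
    by (simp add: \<omega>_def comp_simps)
  also have "\<dots> = farr F \<rho> \<cdot> (m (fobj F B) \<cdot> farr F (\<delta> B)) \<cdot> farr F (\<eta> B)"
    by (simp add: m_nat comp_simps)
  also have "\<dots> = farr F \<rho> \<cdot> \<delta> B \<cdot> \<kappa> B"
    by (simp add: Frobenius_right[symmetric] \<kappa>_def comp_simps)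
  finally have mF\<omega>: "\<omega> \<cdot> \<rho> = m B \<cdot> farr F \<omega>" by (simp add: \<delta>_\<kappa> \<omega>\<rho>)
  \<comment> \<open>Unfolding only the right-hand \<open>\<omega>\<close> makes
    \<open>\<omega> \<cdot> \<rho>\<close> appear under \<open>F\<close>.\<close>
  have "farr F \<omega> \<cdot> \<omega> = farr F (\<omega> \<cdot> \<rho>) \<cdot> \<delta> B \<cdot> \<eta> B"
    by (subst (2) \<omega>_def) (simp add: comp_simps)
  also have "\<dots> = farr F (farr F \<rho>) \<cdot> (farr F (\<delta> B) \<cdot> \<delta> B) \<cdot> \<eta> B"
    by (simp add: \<omega>\<rho>[symmetric] comp_simps)
  also have "\<dots> = (farr F (farr F \<rho>) \<cdot> \<delta> (fobj F B)) \<cdot> \<delta> B \<cdot> \<eta> B"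
    by (simp add: \<delta>_coassoc comp_simps)
  also have "\<dots> = (\<delta> B \<cdot> farr F \<rho>) \<cdot> \<delta> B \<cdot> \<eta> B"
    by (simp add: \<delta>_nat)
  also have "\<dots> = \<delta> B \<cdot> \<omega>"
    by (simp add: \<omega>_def comp_simps)
  finally have \<omega>_comod: "farr F \<omega> \<cdot> \<omega> = \<delta> B \<cdot> \<omega>" .
  have "\<kappa> B \<cdot> \<omega> = (\<kappa> B \<cdot> farr F \<rho>) \<cdot> \<delta> B \<cdot> \<eta> B"
    by (simp add: \<omega>_def comp_simps)
  also have "\<dots> = farr F \<rho> \<cdot> (\<kappa> (fobj F B) \<cdot> \<delta> B) \<cdot> \<eta> B"
    by (simp add: \<kappa>_nat comp_simps)
  also have "\<dots> = \<omega>"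
    by (simp add: \<kappa>_\<delta> \<omega>_def)
  finally have "\<kappa> B \<cdot> \<omega> = \<omega>" .
  with \<omega>\<rho> mF\<omega> \<omega>_comod have "compatible_bimodule (B, \<rho>, \<omega>)"
    by (intro compatible_bimoduleI) simp_all
  then show ?thesis by (simp add: \<omega>_def)
qed

lemma compatible_bimoduleD:
  assumes "compatible_bimodule (B, \<rho>, \<omega>)"
  shows "compatible_comodule C F \<delta> \<epsilon> (B, \<omega>)" "compatible_module C F m \<eta> (B, \<rho>)"
    and "farr F \<rho> \<cdot> \<delta> B = \<omega> \<cdot> \<rho>" "\<omega> \<cdot> \<rho> = m B \<cdot> farr F \<omega>"
  using assms by (auto simp: compatible_bimodule_def Frobenius_bimodule_def)

text \<open>These equations are what makes \<open>\<Psi>\<close> after \<open>forget_module\<close>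
  and \<open>\<Phi>\<close> after \<open>forget_comodule\<close> the identity on objects. The first
  uses compatibility of the module, the second that of the comodule.\<close>

lemma compatible_bimodule_unique:
  assumes "compatible_bimodule (B, \<rho>, \<omega>)"
  shows module_of_comodule: "\<epsilon> B \<cdot> m B \<cdot> farr F \<omega> = \<rho>"
    and comodule_of_module: "farr F \<rho> \<cdot> \<delta> B \<cdot> \<eta> B = \<omega>"
proof -
  note bimod = compatible_bimoduleD[OF assms]
  note [simp] = compatible_comoduleD[OF bimod(1)] compatible_moduleD[OF bimod(2)]
  have "\<epsilon> B \<cdot> m B \<cdot> farr F \<omega> = (\<epsilon> B \<cdot> farr F \<rho>) \<cdot> \<delta> B"
    by (simp add: bimod(3) bimod(4)[symmetric] comp_simps)
  also have "\<dots> = \<rho> \<cdot> \<kappa> B"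
    using \<kappa>_counit_right[of B] by (simp add: counit_nat comp_simps)
  finally show "\<epsilon> B \<cdot> m B \<cdot> farr F \<omega> = \<rho>" by simp
  have "farr F \<rho> \<cdot> \<delta> B \<cdot> \<eta> B = (farr F \<rho> \<cdot> \<delta> B) \<cdot> \<eta> B"
    by (simp add: comp_simps)
  also have "\<dots> = m B \<cdot> farr F \<omega> \<cdot> \<eta> B"
    by (simp add: bimod(3,4) comp_simps)
  also have "\<dots> = \<kappa> B \<cdot> \<omega>"
    using unit_nat[of \<omega>] by (simp add: \<kappa>_unit comp_simps)
  finally show "farr F \<rho> \<cdot> \<delta> B \<cdot> \<eta> B = \<omega>" by simp
qed

text \<open>A comodule morphism passes through each factor of the induced action:
  \<open>\<epsilon>\<close> and \<open>m\<close> by naturality, \<open>farr F \<omega>\<close> by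
  the image of the morphism law under \<open>F\<close>.\<close>

lemma module_morphism_of_comodule_morphism:
  assumes "compatible_comodule C F \<delta> \<epsilon> (B, \<omega>)" "compatible_comodule C F \<delta> \<epsilon> (B', \<omega>')"
    and "comodule_morphism C F (B, \<omega>) (B', \<omega>') f"
  shows "module_morphism C F (B, \<epsilon> B \<cdot> m B \<cdot> farr F \<omega>) (B', \<epsilon> B' \<cdot> m B' \<cdot> farr F \<omega>') f"
proof -
  note [simp] = compatible_comoduleD[OF assms(1)] compatible_comoduleD[OF assms(2)]
  have [simp]: "f \<in> Arr C" "Dom C f = B" "Cod C f = B'" and f: "\<omega>' \<cdot> f = farr F f \<cdot> \<omega>"
    using assms(3) by (auto simp: comodule_morphism_def hom_def)
  have "f \<cdot> \<epsilon> B \<cdot> m B \<cdot> farr F \<omega> = (f \<cdot> \<epsilon> B) \<cdot> m B \<cdot> farr F \<omega>"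
    by (simp add: comp_simps)
  also have "\<dots> = \<epsilon> B' \<cdot> (farr F f \<cdot> m B) \<cdot> farr F \<omega>"
    by (simp add: counit_nat[of f B', simplified, symmetric]) (simp add: comp_simps)
  also have "\<dots> = \<epsilon> B' \<cdot> (m B' \<cdot> farr F (farr F f)) \<cdot> farr F \<omega>"
    by (simp add: m_nat)
  \<comment> \<open>The morphism law must rewrite \<open>\<omega>' \<cdot> f\<close> before
    functoriality splits it, hence two separate simplifications.\<close>
  also have "\<dots> = \<epsilon> B' \<cdot> m B' \<cdot> farr F (\<omega>' \<cdot> f)"
    by (simp add: f) (simp add: comp_simps)
  also have "\<dots> = (\<epsilon> B' \<cdot> m B' \<cdot> farr F \<omega>') \<cdot> farr F f"
    by (simp add: comp_simps)
  finally show ?thesis by (simp add: module_morphism_def hom_def)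
qed

text \<open>The dual argument, with naturality of \<open>\<eta>\<close> and
  \<open>\<delta>\<close>.\<close>

lemma comodule_morphism_of_module_morphism:
  assumes "compatible_module C F m \<eta> (B, \<rho>)" "compatible_module C F m \<eta> (B', \<rho>')"
    and "module_morphism C F (B, \<rho>) (B', \<rho>') f"
  shows "comodule_morphism C F (B, farr F \<rho> \<cdot> \<delta> B \<cdot> \<eta> B) (B', farr F \<rho>' \<cdot> \<delta> B' \<cdot> \<eta> B') f"
proof -
  note [simp] = compatible_moduleD[OF assms(1)] compatible_moduleD[OF assms(2)]
  have [simp]: "f \<in> Arr C" "Dom C f = B" "Cod C f = B'" and f: "f \<cdot> \<rho> = \<rho>' \<cdot> farr F f"
    using assms(3) by (auto simp: module_morphism_def hom_def)
  have "(farr F \<rho>' \<cdot> \<delta> B' \<cdot> \<eta> B') \<cdot> f = farr F \<rho>' \<cdot> \<delta> B' \<cdot> \<eta> B' \<cdot> f"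
    by (simp add: comp_simps)
  also have "\<dots> = farr F \<rho>' \<cdot> (\<delta> B' \<cdot> farr F f) \<cdot> \<eta> B"
    using unit_nat[of f] by (simp add: comp_simps)
  also have "\<dots> = farr F (\<rho>' \<cdot> farr F f) \<cdot> \<delta> B \<cdot> \<eta> B"
    by (simp add: \<delta>_nat comp_simps)
  also have "\<dots> = farr F f \<cdot> farr F \<rho> \<cdot> \<delta> B \<cdot> \<eta> B"
    by (simp add: f[symmetric]) (simp add: comp_simps)
  finally show ?thesis by (simp add: comodule_morphism_def hom_def)
qed

section \<open>Identities and composites of morphisms\<close>

lemma module_morphism_hom: "module_morphism C F (B, \<rho>) (B', \<rho>') f \<Longrightarrow> f \<in> hom C B B'"
  by (simp add: module_morphism_def)

lemma comodule_morphism_hom: "comodule_morphism C F (B, \<omega>) (B', \<omega>') f \<Longrightarrow> f \<in> hom C B B'"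
  by (simp add: comodule_morphism_def)

lemma module_morphism_id:
  assumes "\<rho> \<in> hom C (fobj F B) B"
  shows "module_morphism C F (B, \<rho>) (B, \<rho>) (Id C B)"
proof -
  have "B \<in> Obj C" using assms F.source.cod_obj by (auto simp: hom_def)
  then show ?thesis
    using assms cat_functor.farr_id[OF functor_F] F.source.id_hom F.source.id_left F.source.id_right
    by (simp add: module_morphism_def)
qed

lemma comodule_morphism_id:
  assumes "\<omega> \<in> hom C B (fobj F B)"
  shows "comodule_morphism C F (B, \<omega>) (B, \<omega>) (Id C B)"
proof -
  have "B \<in> Obj C" using assms F.source.dom_obj by (auto simp: hom_def)
  then show ?thesis
    using assms cat_functor.farr_id[OF functor_F] F.source.id_hom F.source.id_left F.source.id_right
    by (simp add: comodule_morphism_def)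
qed

text \<open>Two commuting squares are pasted. \<open>module_morphism\<close> does not type the
  structure maps, so their homs are assumed for associativity.\<close>

lemma module_morphism_comp:
  assumes "\<rho> \<in> hom C (fobj F B) B" "\<rho>' \<in> hom C (fobj F B') B'" "\<rho>'' \<in> hom C (fobj F B'') B''"
    and "module_morphism C F (B, \<rho>) (B', \<rho>') f" "module_morphism C F (B', \<rho>') (B'', \<rho>'') g"
  shows "module_morphism C F (B, \<rho>) (B'', \<rho>'') (g \<cdot> f)"
proof -
  note [simp] = F.source.comp_arr
  have [simp]: "f \<in> Arr C" "Dom C f = B" "Cod C f = B'" "g \<in> Arr C" "Dom C g = B'" "Cod C g = B''"
      "\<rho> \<in> Arr C" "Dom C \<rho> = fobj F B" "Cod C \<rho> = B"
      "\<rho>' \<in> Arr C" "Dom C \<rho>' = fobj F B'" "Cod C \<rho>' = B'"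
      "\<rho>'' \<in> Arr C" "Dom C \<rho>'' = fobj F B''" "Cod C \<rho>'' = B''"
    and f: "f \<cdot> \<rho> = \<rho>' \<cdot> farr F f" and g: "g \<cdot> \<rho>' = \<rho>'' \<cdot> farr F g"
    using assms by (auto simp: module_morphism_def hom_def)
  have "g \<cdot> f \<cdot> \<rho> = \<rho>'' \<cdot> farr F g \<cdot> farr F f"
    unfolding f by (simp add: comp_eq_extend[OF g] F.source.assoc_arr)
  then show ?thesis
    by (simp add: module_morphism_def hom_def F_comp F.source.assoc_arr)
qed

lemma comodule_morphism_comp:
  assumes "\<omega> \<in> hom C B (fobj F B)" "\<omega>' \<in> hom C B' (fobj F B')" "\<omega>'' \<in> hom C B'' (fobj F B'')"
    and "comodule_morphism C F (B, \<omega>) (B', \<omega>') f" "comodule_morphism C F (B', \<omega>') (B'', \<omega>'') g"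
  shows "comodule_morphism C F (B, \<omega>) (B'', \<omega>'') (g \<cdot> f)"
proof -
  note [simp] = F.source.comp_arr
  have [simp]: "f \<in> Arr C" "Dom C f = B" "Cod C f = B'" "g \<in> Arr C" "Dom C g = B'" "Cod C g = B''"
      "\<omega> \<in> Arr C" "Dom C \<omega> = B" "Cod C \<omega> = fobj F B"
      "\<omega>' \<in> Arr C" "Dom C \<omega>' = B'" "Cod C \<omega>' = fobj F B'"
      "\<omega>'' \<in> Arr C" "Dom C \<omega>'' = B''" "Cod C \<omega>'' = fobj F B''"
    and f: "\<omega>' \<cdot> f = farr F f \<cdot> \<omega>" and g: "\<omega>'' \<cdot> g = farr F g \<cdot> \<omega>'"
    using assms by (auto simp: comodule_morphism_def hom_def)
  have "\<omega>'' \<cdot> g \<cdot> f = farr F g \<cdot> farr F f \<cdot> \<omega>"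
    by (simp add: comp_eq_extend[OF g] F.source.assoc_arr f)
  then show ?thesis
    by (simp add: comodule_morphism_def hom_def F_comp F.source.assoc_arr)
qed

section \<open>The three categories and the four functors\<close>

lemma compatible_bimodules_eq:
  "compatible_Frobenius_bimodules C F m \<eta> \<delta> \<epsilon> = structured_category C fst compatible_bimodule
    (\<lambda>(B, \<rho>, \<omega>) (B', \<rho>', \<omega>') f.
      module_morphism C F (B, \<rho>) (B', \<rho>') f \<and> comodule_morphism C F (B, \<omega>) (B', \<omega>') f)"
  unfolding compatible_Frobenius_bimodules_def compatible_bimodule_def ..

lemma compatible_module_hom:
  "compatible_module C F m \<eta> (B, \<rho>) \<Longrightarrow> \<rho> \<in> hom C (fobj F B) B"
  using compatible_moduleD by (simp add: hom_def)

lemma compatible_comodule_hom: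
  "compatible_comodule C F \<delta> \<epsilon> (B, \<omega>) \<Longrightarrow> \<omega> \<in> hom C B (fobj F B)"
  using compatible_comoduleD by (simp add: hom_def)

lemma category_compatible_modules: "category (compatible_modules C F m \<eta>)"
  unfolding compatible_modules_def
  by (rule category_structured_category)
    (auto intro: F.source.category_axioms module_morphism_id[OF compatible_module_hom]
      module_morphism_comp compatible_module_hom compatible_moduleD(1) module_morphism_hom)

lemma category_compatible_comodules: "category (compatible_comodules C F \<delta> \<epsilon>)"
  unfolding compatible_comodules_def
  by (rule category_structured_category)
    (auto intro: F.source.category_axioms comodule_morphism_id[OF compatible_comodule_hom]
      comodule_morphism_comp compatible_comodule_hom compatible_comoduleD(1) comodule_morphism_hom)

lemma category_compatible_bimodules:
  "category (compatible_Frobenius_bimodules C F m \<eta> \<delta> \<epsilon>)"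
  unfolding compatible_bimodules_eq
proof (rule category_structured_category, goal_cases)
  case 1
  show ?case by (rule F.source.category_axioms)
qed (auto intro: module_morphism_id[OF compatible_module_hom, OF compatible_bimoduleD(2)]
    comodule_morphism_id[OF compatible_comodule_hom, OF compatible_bimoduleD(1)]
    module_morphism_comp comodule_morphism_comp module_morphism_hom
    compatible_module_hom[OF compatible_bimoduleD(2)]
    compatible_comodule_hom[OF compatible_bimoduleD(1)]
    compatible_moduleD(1)[OF compatible_bimoduleD(2)])

lemmas category_compatible =
  category_compatible_modules[unfolded compatible_modules_def]
  category_compatible_comodules[unfolded compatible_comodules_def]
  category_compatible_bimodules[unfolded compatible_bimodules_eq]

lemma cat_functor_\<Psi>:
  "cat_functor (compatible_comodules C F \<delta> \<epsilon>) (compatible_Frobenius_bimodules C F m \<eta> \<delta> \<epsilon>)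
    (\<Psi> C F m \<epsilon>)"
  unfolding \<Psi>_def compatible_comodules_def compatible_bimodules_eq
  by (rule cat_functor_structured_functor[OF category_compatible(2,3)])
    (auto intro: compatible_bimodule_of_comodule module_morphism_of_comodule_morphism)

lemma cat_functor_\<Phi>:
  "cat_functor (compatible_modules C F m \<eta>) (compatible_Frobenius_bimodules C F m \<eta> \<delta> \<epsilon>)
    (\<Phi> C F \<delta> \<eta>)"
  unfolding \<Phi>_def compatible_modules_def compatible_bimodules_eq
  by (rule cat_functor_structured_functor[OF category_compatible(1,3)])
    (auto intro: compatible_bimodule_of_module comodule_morphism_of_module_morphism)

lemma cat_functor_forget_comodule:
  "cat_functor (compatible_Frobenius_bimodules C F m \<eta> \<delta> \<epsilon>) (compatible_modules C F m \<eta>)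
    forget_comodule"
  unfolding forget_comodule_def compatible_modules_def compatible_bimodules_eq
  by (rule cat_functor_structured_functor[OF category_compatible(3,1)])
    (auto dest: compatible_bimoduleD)

lemma cat_functor_forget_module:
  "cat_functor (compatible_Frobenius_bimodules C F m \<eta> \<delta> \<epsilon>) (compatible_comodules C F \<delta> \<epsilon>)
    forget_module"
  unfolding forget_module_def compatible_comodules_def compatible_bimodules_eq
  by (rule cat_functor_structured_functor[OF category_compatible(3,2)])
    (auto dest: compatible_bimoduleD)

section \<open>Inverse functors and isomorphisms\<close>

lemma \<Psi>_forget_module_inverse:
  "functor_eq (compatible_comodules C F \<delta> \<epsilon>) (forget_module \<circ>\<^sub>F \<Psi> C F m \<epsilon>) id_functor"
  "functor_eq (compatible_Frobenius_bimodules C F m \<eta> \<delta> \<epsilon>) (\<Psi> C F m \<epsilon> \<circ>\<^sub>F forget_module) id_functor"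
  unfolding forget_module_def \<Psi>_def compatible_comodules_def compatible_bimodules_eq
    structured_functor_comp
  by (rule functor_eq_structured_functor_id; auto simp: module_of_comodule)+

text \<open>On modules the composite is the identity because \<open>\<Phi>\<close> keeps
  \<open>\<rho>\<close>; on bimodules \<open>\<omega>\<close> is recovered by
  \<open>comodule_of_module\<close>.\<close>

lemma \<Phi>_forget_comodule_inverse:
  "functor_eq (compatible_modules C F m \<eta>) (forget_comodule \<circ>\<^sub>F \<Phi> C F \<delta> \<eta>) id_functor"
  "functor_eq (compatible_Frobenius_bimodules C F m \<eta> \<delta> \<epsilon>) (\<Phi> C F \<delta> \<eta> \<circ>\<^sub>F forget_comodule) id_functor"
  unfolding forget_comodule_def \<Phi>_def compatible_modules_def compatible_bimodules_eq
    structured_functor_comp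
  by (rule functor_eq_structured_functor_id; auto simp: comodule_of_module)+

lemmas bimodule_isomorphisms =
  category_isomorphismI[OF cat_functor_\<Psi> cat_functor_forget_module \<Psi>_forget_module_inverse]
  category_isomorphismI[OF cat_functor_forget_module cat_functor_\<Psi> \<Psi>_forget_module_inverse(2,1)]
  category_isomorphismI[OF cat_functor_\<Phi> cat_functor_forget_comodule \<Phi>_forget_comodule_inverse]
  category_isomorphismI[OF cat_functor_forget_comodule cat_functor_\<Phi> \<Phi>_forget_comodule_inverse(2,1)]

end

theorem theorem4p6:
  fixes \<B> :: "('o, 'a) category"
    and F :: "('o, 'a, 'o, 'a) cfunctor"
    and m \<eta> \<delta> \<epsilon> :: "'o \<Rightarrow> 'a"
  assumes "weak_Frobenius_monad \<B> F m \<eta> \<delta> \<epsilon>"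
  shows "let \<C> = compatible_comodules \<B> F \<delta> \<epsilon>;
             \<M> = compatible_modules \<B> F m \<eta>;
             \<D> = compatible_Frobenius_bimodules \<B> F m \<eta> \<delta> \<epsilon>
         in cat_functor \<C> \<D> (\<Psi> \<B> F m \<epsilon>) \<and>
            cat_functor \<M> \<D> (\<Phi> \<B> F \<delta> \<eta>) \<and>
            cat_functor \<D> \<M> forget_comodule \<and>
            cat_functor \<D> \<C> forget_module \<and>
            category_isomorphism \<C> \<D> (\<Psi> \<B> F m \<epsilon>) \<and>
            category_isomorphism \<D> \<M> forget_comodule \<and>
            category_isomorphism \<C> \<M> (forget_comodule \<circ>\<^sub>F \<Psi> \<B> F m \<epsilon>) \<and>
            category_isomorphism \<M> \<D> (\<Phi> \<B> F \<delta> \<eta>) \<and>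
            category_isomorphism \<D> \<C> forget_module \<and>
            category_isomorphism \<M> \<C> (forget_module \<circ>\<^sub>F \<Phi> \<B> F \<delta> \<eta>)"
proof -
  interpret weak_Frobenius_monad \<B> F m \<eta> \<delta> \<epsilon> by fact
  \<comment> \<open>\<open>\<Psi>\<close> is inverse to \<open>forget_module\<close> and
    \<open>\<Phi>\<close> to \<open>forget_comodule\<close>, so all four are isomorphisms; each
    displayed composite joins one from either pair.\<close>
  show ?thesis
    unfolding Let_def
    by (intro conjI cat_functor_\<Psi> cat_functor_\<Phi> cat_functor_forget_comodule
        cat_functor_forget_module bimodule_isomorphisms
        category_isomorphism_comp[OF bimodule_isomorphisms(1,4)]
        category_isomorphism_comp[OF bimodule_isomorphisms(3,2)])
qed

end
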